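(* Let $q$ be a prime power, $n$ a positive integer, $I,J$ positive integers with $I<J<n$, and put $K:=J-I$. Let $\alpha,\beta,\gamma\in\mathbb{F}_{q^n}^*$. Assume that $\gcd(I,J,n)=1$ and that $\alpha\,\gamma^{q^{K}}\beta^{q^{K}+1}$ is not an $A$-th power in $\mathbb{F}_{q^n}$, where $A:=q^{2K}+q^{K}+1$ (i.e. there is no $\xi\in\mathbb{F}_{q^n}$ with $\xi^{A}=\alpha\gamma^{q^{K}}\beta^{q^{K}+1}$). Then the set $$U_{\alpha,\beta,\gamma}^{I,J,n}:=\{(x,y,z,\;x^{q^I}+\alpha y^{q^J},\;x^{q^J}+\beta z^{q^I},\;y^{q^I}+\gamma z^{q^J}) : x,y,z\in\mathbb{F}_{q^n}\}\subseteq\mathbb{F}_{q^n}^6$$ is scattered.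
   Context: An $\mathbb{F}_q$-subspace $U$ of $\mathbb{F}_{q^n}^6$ is called scattered if every one-dimensional $\mathbb{F}_{q^n}$-subspace of $\mathbb{F}_{q^n}^6$ meets $U$ in an $\mathbb{F}_q$-subspace of $\mathbb{F}_q$-dimension at most $1$; equivalently, if $u\in U\setminus\{0\}$, $\lambda\in\mathbb{F}_{q^n}$ and $\lambda u\in U$, then $\lambda\in\mathbb{F}_q$. *)

theory Defs
  imports "HOL-Analysis.Analysis" "HOL-Number_Theory.Prime_Powers"
begin

(* The field extension F_q \<subseteq> F_{q^n} is given by a unital ring homomorphism (automatically
   injective) from a field type 'k into a field type 'a, so that vectors over 'a form a vector
   space over 'k and the library's subspace and dim apply to both scalar fields. *)

definition field_embedding :: "('k::field \<Rightarrow> 'a::field) \<Rightarrow> bool" where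
  "field_embedding \<iota> \<longleftrightarrow>
     \<iota> 1 = 1 \<and> (\<forall>a b. \<iota> (a + b) = \<iota> a + \<iota> b) \<and> (\<forall>a b. \<iota> (a * b) = \<iota> a * \<iota> b)"

definition restr_scale :: "('k::field \<Rightarrow> 'a::field) \<Rightarrow> 'k \<Rightarrow> 'a^'m \<Rightarrow> 'a^'m" where
  "restr_scale \<iota> c v = \<iota> c *s v"

lemma vector_space_restr_scale:
  assumes "field_embedding \<iota>"
  shows "vector_space (restr_scale \<iota> :: 'k::field \<Rightarrow> ('a::field)^'m \<Rightarrow> 'a^'m)"
  using assms by unfold_locales
    (auto simp: field_embedding_def restr_scale_def vec_eq_iff algebra_simps)

definition scattered :: "('k::field \<Rightarrow> 'a::field) \<Rightarrow> ('a^'m::finite) set \<Rightarrow> bool" where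
  "scattered \<iota> U \<longleftrightarrow>
     module.subspace (restr_scale \<iota>) U \<and>
     (\<forall>L. vec.subspace L \<and> vec.dim L = 1 \<longrightarrow>
        vector_space.dim (restr_scale \<iota>) (U \<inter> L) \<le> 1)"

definition U_set :: "nat \<Rightarrow> nat \<Rightarrow> nat \<Rightarrow> 'a::field \<Rightarrow> 'a \<Rightarrow> 'a \<Rightarrow> ('a^6) set" where
  "U_set q I J \<alpha> \<beta> \<gamma> =
     {vector [x, y, z,
              x ^ (q ^ I) + \<alpha> * y ^ (q ^ J),
              x ^ (q ^ J) + \<beta> * z ^ (q ^ I),
              y ^ (q ^ I) + \<gamma> * z ^ (q ^ J)] | x y z. True}"

(* The index type 6 consists of the residues modulo 6, so the last component is also $ 0. *)
lemma vector_6 [simp]: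
  "(vector [a, b, c, d, e, f] :: ('a::zero)^6) $ 1 = a"
  "(vector [a, b, c, d, e, f] :: ('a::zero)^6) $ 2 = b"
  "(vector [a, b, c, d, e, f] :: ('a::zero)^6) $ 3 = c"
  "(vector [a, b, c, d, e, f] :: ('a::zero)^6) $ 4 = d"
  "(vector [a, b, c, d, e, f] :: ('a::zero)^6) $ 5 = e"
  "(vector [a, b, c, d, e, f] :: ('a::zero)^6) $ 6 = f"
  unfolding vector_def by simp_all

end

theory Submission
  imports Defs
begin

text \<open>
  If \<open>u = (x, y, z, \<dots>)\<close> is nonzero and both \<open>u\<close> and \<open>\<lambda>u\<close> lie in the set, then, with
  \<open>a = \<lambda> - \<lambda>^q^I\<close> and \<open>b = \<lambda> - \<lambda>^q^J\<close>, comparing the last three coordinates gives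
  \<open>a X = - \<alpha> b Y^s\<close>, \<open>b X^s = - \<beta> a Z\<close>, \<open>a Y = - \<gamma> b Z^s\<close>, where \<open>s = q^K\<close> and
  \<open>X, Y, Z\<close> are the \<open>q^I\<close>-th powers of \<open>x, y, z\<close>. If exactly one of \<open>a, b\<close> vanishes, then \<open>u = 0\<close>;
  if neither does, eliminating \<open>Y\<close> and \<open>b / a\<close> shows that \<open>X / Z\<close> is an \<open>A\<close>-th root of
  \<open>\<alpha> \<gamma>^s \<beta>^(s+1)\<close>. Hence \<open>a = b = 0\<close>, so \<open>\<lambda>\<close> is fixed by the \<open>q\<close>-power map, whose fixed
  points are exactly the images of elements of the small field.
\<close>

section \<open>Frobenius powers in finite fields\<close>

lemma power_card_eq_self:
  fixes x :: "'a::{field,finite}"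
  shows "x ^ CARD('a) = x"
proof (cases "x = 0")
  case False
  \<comment> \<open>Multiplication by a nonzero \<open>x\<close> permutes the nonzero elements;
    cancelling their product leaves \<open>x ^ (CARD('a) - 1) = 1\<close>.\<close>
  have "bij_betw ((*) x) (UNIV - {0}) (UNIV - {0})"
    using False by (intro bij_betw_byWitness[where f' = "\<lambda>y. y / x"]) auto
  then have "(\<Prod>y\<in>UNIV - {0}. x * y) = \<Prod>(UNIV - {0})"
    by (rule prod.reindex_bij_betw)
  then have "x ^ (CARD('a) - 1) = 1"
    by (simp add: prod.distrib)
  moreover have "CARD('a) = Suc (CARD('a) - 1)"
    by simp
  ultimately show ?thesis
    by (metis mult.right_neutral power_Suc)
qed (simp add: zero_power)

lemma power_iterate_fixed:
  fixes x :: "'a::monoid_mult"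
  assumes "x ^ m = x"
  shows "x ^ (m ^ k) = x"
  using assms by (induction k) (simp_all add: power_mult)

text \<open>Bezout in the subtraction-free form \<open>i * k = j * l + gcd i j\<close> keeps all
  exponents natural, so no inverse Frobenius is needed.\<close>

lemma power_gcd_fixed:
  fixes x :: "'a::monoid_mult"
  assumes "x ^ (q ^ i) = x" and "x ^ (q ^ j) = x"
  shows "x ^ (q ^ gcd i j) = x"
proof (cases "i = 0")
  case False
  then obtain k l where kl: "i * k = j * l + gcd i j"
    using bezout_nat by blast
  have "x = x ^ (q ^ (i * k))"
    using power_iterate_fixed[OF assms(1), of k] by (simp add: power_mult)
  also have "\<dots> = (x ^ (q ^ (j * l))) ^ (q ^ gcd i j)"
    by (simp add: kl power_add power_mult)
  also have "x ^ (q ^ (j * l)) = x"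
    using power_iterate_fixed[OF assms(2), of l] by (simp add: power_mult)
  finally show ?thesis by simp
qed (use assms in simp)

text \<open>Translation by 1 permutes the ring, so summing all elements before and after it gives
  \<open>of_nat CARD('a) = 0\<close>.\<close>

lemma CHAR_dvd_CARD_finite: "CHAR('a::{comm_ring_1,finite}) dvd CARD('a)"
proof -
  have "(\<Sum>x\<in>UNIV. x + 1 :: 'a) = (\<Sum>x\<in>UNIV. x)"
    by (rule sum.reindex_bij_betw, rule bij_betw_byWitness[where f' = "\<lambda>x. x - 1"]) auto
  then have "of_nat CARD('a) = (0 :: 'a)"
    by (simp add: sum.distrib)
  then show ?thesis
    by (simp add: of_nat_eq_0_iff_char_dvd)
qed

text \<open>The cardinality ties \<open>q\<close> to the field: the characteristic is a prime
  dividing a power of \<open>p\<close>, hence equals \<open>p\<close>, and \<open>q ^ m\<close> is a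
  power of it.\<close>

lemma freshmans_dream_CARD:
  fixes x y :: "'a::{field,finite}"
  assumes "primepow q" and "CARD('a) = q ^ n"
  shows "(x + y) ^ (q ^ m) = x ^ (q ^ m) + y ^ (q ^ m)"
proof -
  obtain p k where p: "prime p" "q = p ^ k"
    using assms(1) by (auto simp: primepow_def)
  have C: "prime CHAR('a)"
    by (intro prime_CHAR_semidom finite_imp_CHAR_pos) simp
  have "CHAR('a) dvd p ^ (k * n)"
    using CHAR_dvd_CARD_finite[where ?'a = 'a] assms(2) p by (simp add: power_mult)
  then have "CHAR('a) = p"
    using C p(1) prime_dvd_power primes_dvd_imp_eq by blast
  then show ?thesis
    using p C by (intro freshmans_dream'[where n = "k * m"]) (simp_all add: power_mult)
qed

section \<open>The small field as the fixed points of the \<open>q\<close>-power map\<close>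

lemma
  assumes "field_embedding \<iota>"
  shows field_embedding_inj: "inj \<iota>"
    and field_embedding_power: "\<iota> (c ^ m) = \<iota> c ^ m"
proof -
  have add: "\<iota> (a + b) = \<iota> a + \<iota> b" and mult: "\<iota> (a * b) = \<iota> a * \<iota> b" and one: "\<iota> 1 = 1" for a b
    using assms by (auto simp: field_embedding_def)
  show "inj \<iota>"
  proof (rule injI)
    fix a b assume ab: "\<iota> a = \<iota> b"
    have "\<iota> (a - b) = 0"
      using add[of "a - b" b] ab by simp
    then have "\<not> a - b \<noteq> 0"
      using mult[of "a - b" "inverse (a - b)"] one by (metis mult_zero_left right_inverse zero_neq_one)
    then show "a = b" by simp
  qed
  show "\<iota> (c ^ m) = \<iota> c ^ m"
    by (induction m) (simp_all add: mult one)
qed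

text \<open>The image of the embedding already supplies \<open>CARD('k)\<close> roots of the
  polynomial \<open>p\<close>, whose degree allows no more.\<close>

lemma power_CARD_fixed_iff_range:
  fixes \<iota> :: "'k::{field,finite} \<Rightarrow> 'a::field"
  assumes "field_embedding \<iota>"
  shows "x ^ CARD('k) = x \<longleftrightarrow> x \<in> range \<iota>"
proof -
  let ?q = "CARD('k)"
  define p :: "'a poly" where "p = monom 1 ?q - monom 1 1"
  have "card {0, 1 :: 'k} \<le> ?q" by (intro card_mono) auto
  then have q: "?q > 1" by simp
  have roots: "{x. poly p x = 0} = {x. x ^ ?q = x}"
    by (simp add: p_def poly_monom)
  have "poly.coeff p ?q = 1"
    using q by (simp add: p_def)
  then have "p \<noteq> 0" by auto
  have "degree p \<le> ?q"
    using q unfolding p_def by (intro degree_diff_le) (auto intro: order.trans[OF degree_monom_le])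
  then have "card {x::'a. x ^ ?q = x} \<le> ?q"
    using card_poly_roots_bound[OF \<open>p \<noteq> 0\<close>] by (simp add: roots)
  also have "?q = card (range \<iota>)"
    using field_embedding_inj[OF assms] by (simp add: card_image)
  finally have "card {x::'a. x ^ ?q = x} \<le> card (range \<iota>)" .
  moreover have "range \<iota> \<subseteq> {x. x ^ ?q = x}"
    by (auto simp: power_card_eq_self simp flip: field_embedding_power[OF assms])
  moreover have "finite {x::'a. x ^ ?q = x}"
    using poly_roots_finite[OF \<open>p \<noteq> 0\<close>] by (simp add: roots)
  ultimately have "range \<iota> = {x. x ^ ?q = x}"
    by (meson card_seteq)
  then show ?thesis by auto
qed

section \<open>A scalar criterion for scatteredness\<close>

lemma scatteredI:
  fixes \<iota> :: "'k::field \<Rightarrow> 'a::field" and U :: "('a^'m::finite) set"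
  assumes \<iota>: "field_embedding \<iota>"
    and U: "module.subspace (restr_scale \<iota>) U"
    and ratio: "\<And>u c. \<lbrakk>u \<in> U; u \<noteq> 0; c *s u \<in> U\<rbrakk> \<Longrightarrow> c \<in> range \<iota>"
  shows "scattered \<iota> U"
  unfolding scattered_def
proof (intro conjI allI impI U)
  interpret V: vector_space "restr_scale \<iota> :: 'k \<Rightarrow> 'a^'m \<Rightarrow> 'a^'m"
    using vector_space_restr_scale[OF \<iota>] .
  fix L :: "('a^'m) set" assume L: "vec.subspace L \<and> vec.dim L = 1"
  show "V.dim (U \<inter> L) \<le> 1"
  proof (cases "U \<inter> L \<subseteq> {0}")
    case True
    then show ?thesis
      using V.dim_le_card[of "U \<inter> L" "{}"] by simp
  next
    case False
    then obtain u where u: "u \<in> U" "u \<in> L" "u \<noteq> 0" by auto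
    obtain B where B: "L \<subseteq> vec.span B" "card B = 1"
      using vec.basis_exists L by metis
    then obtain v where v: "L \<subseteq> vec.span {v}"
      by (metis card_1_singletonE)
    then obtain d where d: "u = d *s v"
      using u(2) unfolding vec.span_singleton by blast
    \<comment> \<open>One nonzero \<open>u\<close> in the intersection spans all of it over the
      small field: any other \<open>w\<close> is a multiple of \<open>u\<close>, and
      \<open>ratio\<close> puts the factor in the image.\<close>
    have "w \<in> V.span {u}" if w_in: "w \<in> U" "w \<in> L" for w
    proof -
      obtain e where e: "w = e *s v"
        using v w_in(2) unfolding vec.span_singleton by blast
      have w: "w = (e / d) *s u"
        using u d e by auto
      then obtain c where "e / d = \<iota> c"
        using ratio[of u "e / d"] u w_in by auto
      then have "w = restr_scale \<iota> c u"
        using w by (simp add: restr_scale_def)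
      then show ?thesis
        by (simp add: V.span_base V.span_scale)
    qed
    then show ?thesis
      using V.dim_le_card[of "U \<inter> L" "{u}"] by auto
  qed
qed

text \<open>Inserting the third equation into the first cancels the signs and leaves a factor
  \<open>t * t ^ s\<close>. Multiplying by \<open>X ^ (s\<^sup>2 + s)\<close> completes it to
  \<open>t * X ^ s\<close> times its own \<open>s\<close>-th power, which the second equation
  evaluates.\<close>

lemma cyclic_system_ratio_power:
  fixes X Y Z a b :: "'a::field"
  assumes neg: "\<And>w::'a. (- w) ^ s = - (w ^ s)"
    and "a \<noteq> 0" "X \<noteq> 0" "Z \<noteq> 0"
    and e1: "a * X = - (\<alpha> * b * Y ^ s)"
    and e2: "b * X ^ s = - (\<beta> * a * Z)"
    and e3: "a * Y = - (\<gamma> * b * Z ^ s)"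
  shows "(X / Z) ^ (s\<^sup>2 + s + 1) = \<alpha> * \<gamma> ^ s * \<beta> ^ (s + 1)"
proof -
  define t where "t = b / a"
  have X: "X = - (\<alpha> * t * Y ^ s)" and Y: "Y = - (\<gamma> * t * Z ^ s)" and tX: "t * X ^ s = - (\<beta> * Z)"
    using e1 e2 e3 \<open>a \<noteq> 0\<close> by (simp_all add: t_def field_simps)
  have "(t * X ^ s) ^ s = - (\<beta> ^ s * Z ^ s)"
    by (simp add: tX neg power_mult_distrib)
  then have tX_s: "t ^ s * X ^ (s\<^sup>2) = - (\<beta> ^ s * Z ^ s)"
    by (simp add: power_mult_distrib power2_eq_square power_mult)
  have "Y ^ s = - (\<gamma> ^ s * t ^ s * Z ^ (s\<^sup>2))"
    by (subst Y) (simp add: neg power_mult_distrib power2_eq_square power_mult)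
  then have "X = \<alpha> * \<gamma> ^ s * (t * t ^ s) * Z ^ (s\<^sup>2)"
    by (subst X) simp
  then have "X ^ (s\<^sup>2 + s + 1) = \<alpha> * \<gamma> ^ s * (t * t ^ s) * Z ^ (s\<^sup>2) * X ^ (s\<^sup>2 + s)"
    by (metis power_add power_one_right mult.commute)
  also have "\<dots> = \<alpha> * \<gamma> ^ s * (t * X ^ s) * (t ^ s * X ^ (s\<^sup>2)) * Z ^ (s\<^sup>2)"
    by (simp add: power_add mult_ac)
  also have "\<dots> = \<alpha> * \<gamma> ^ s * \<beta> ^ (s + 1) * Z ^ (s\<^sup>2 + s + 1)"
    by (simp add: tX tX_s power_add mult_ac)
  finally show ?thesis
    using \<open>Z \<noteq> 0\<close> by (simp add: power_divide del: power_Suc power_add)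
qed

section \<open>The set \<open>U_set\<close> in coordinates\<close>

lemma forall_6: "(\<forall>i::6. P i) \<longleftrightarrow> P 1 \<and> P 2 \<and> P 3 \<and> P 4 \<and> P 5 \<and> P 6"
proof -
  have "i = 1 \<or> i = 2 \<or> i = 3 \<or> i = 4 \<or> i = 5 \<or> i = 6" for i :: 6
  proof (induct i)
    case (of_int z)
    \<comment> \<open>The representatives modulo 6 start at 0, which is the index written 6.\<close>
    then have "z = 0 \<or> z = 1 \<or> z = 2 \<or> z = 3 \<or> z = 4 \<or> z = 5"
      by (simp; arith)
    then show ?case by auto
  qed
  then show ?thesis by metis
qed

text \<open>The set is the image of \<open>?v\<close>, which is additive by the Frobenius identity
  and commutes with scalars from the small field because these are fixed by
  \<open>q\<close>-powers.\<close>

lemma subspace_U_set: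
  fixes \<iota> :: "'k::{field,finite} \<Rightarrow> 'a::{field,finite}"
  assumes "primepow q" and "CARD('k) = q" and "CARD('a) = q ^ n" and \<iota>: "field_embedding \<iota>"
  shows "module.subspace (restr_scale \<iota>) (U_set q I J \<alpha> \<beta> \<gamma>)"
proof -
  interpret V: vector_space "restr_scale \<iota> :: 'k \<Rightarrow> 'a^6 \<Rightarrow> 'a^6"
    using vector_space_restr_scale[OF \<iota>] .
  let ?v = "\<lambda>x y z. vector [x, y, z, x ^ (q ^ I) + \<alpha> * y ^ (q ^ J),
    x ^ (q ^ J) + \<beta> * z ^ (q ^ I), y ^ (q ^ I) + \<gamma> * z ^ (q ^ J)] :: 'a^6"
  have U: "U_set q I J \<alpha> \<beta> \<gamma> = {?v x y z | x y z. True}"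
    by (simp add: U_set_def)
  note frob = freshmans_dream_CARD[OF assms(1,3)]
  have q: "q > 0"
    using assms(2) by auto
  have fixed: "\<iota> c ^ (q ^ m) = \<iota> c" for c m
    using power_CARD_fixed_iff_range[OF \<iota>] assms(2) by (intro power_iterate_fixed) auto
  have zero: "?v 0 0 0 = 0"
    using q by (simp add: vec_eq_iff forall_6 zero_power)
  have add: "?v x y z + ?v x' y' z' = ?v (x + x') (y + y') (z + z')" for x y z x' y' z'
    by (simp add: vec_eq_iff forall_6 frob algebra_simps)
  have scale: "restr_scale \<iota> c (?v x y z) = ?v (\<iota> c * x) (\<iota> c * y) (\<iota> c * z)" for c x y z
    by (simp add: restr_scale_def vec_eq_iff forall_6 power_mult_distrib fixed algebra_simps)
  show ?thesis
    unfolding V.subspace_def U using zero[symmetric] add scale by (auto; blast)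
qed

theorem theorem2p4:
  fixes q n I J K A :: nat
    and \<iota> :: "'k::{field,finite} \<Rightarrow> 'a::{field,finite}"
    and \<alpha> \<beta> \<gamma> :: 'a
  assumes "primepow q"
    and "n > 0"
    and "CARD('k) = q"
    and "CARD('a) = q ^ n"
    and "field_embedding \<iota>"
    and "0 < I" and "I < J" and "J < n"
    and "K = J - I"
    and "A = q ^ (2 * K) + q ^ K + 1"
    and "\<alpha> \<noteq> 0" and "\<beta> \<noteq> 0" and "\<gamma> \<noteq> 0"
    and "Gcd {I, J, n} = 1"
    and "\<not> (\<exists>\<xi>::'a. \<xi> ^ A = \<alpha> * \<gamma> ^ (q ^ K) * \<beta> ^ (q ^ K + 1))"
  shows "scattered \<iota> (U_set q I J \<alpha> \<beta> \<gamma>)"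
proof (rule scatteredI[OF assms(5)])
  show "module.subspace (restr_scale \<iota>) (U_set q I J \<alpha> \<beta> \<gamma>)"
    using assms subspace_U_set by blast
next
  fix u :: "'a^6" and c
  assume u: "u \<in> U_set q I J \<alpha> \<beta> \<gamma>" "u \<noteq> 0" and cu: "c *s u \<in> U_set q I J \<alpha> \<beta> \<gamma>"
  define s where "s = q ^ K"
  have q: "q > 0"
    using assms(3) by auto
  obtain x y z where uv: "u = vector [x, y, z, x ^ (q ^ I) + \<alpha> * y ^ (q ^ J),
      x ^ (q ^ J) + \<beta> * z ^ (q ^ I), y ^ (q ^ I) + \<gamma> * z ^ (q ^ J)]"
    using u(1) unfolding U_set_def by blast
  obtain x' y' z' where cuv: "c *s u = vector [x', y', z', x' ^ (q ^ I) + \<alpha> * y' ^ (q ^ J),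
      x' ^ (q ^ J) + \<beta> * z' ^ (q ^ I), y' ^ (q ^ I) + \<gamma> * z' ^ (q ^ J)]"
    using cu unfolding U_set_def by blast
  define a b where "a = c - c ^ (q ^ I)" and "b = c - c ^ (q ^ J)"
  define X Y Z where "X = x ^ (q ^ I)" and "Y = y ^ (q ^ I)" and "Z = z ^ (q ^ I)"
  have "q ^ J = q ^ I * s"
    using assms(7,9) by (simp add: s_def flip: power_add)
  then have J: "x ^ (q ^ J) = X ^ s" "y ^ (q ^ J) = Y ^ s" "z ^ (q ^ J) = Z ^ s"
    by (simp_all add: X_def Y_def Z_def power_mult)
  have comp: "c * u $ i = (c *s u) $ i" for i
    by simp
  have c': "x' = c * x" "y' = c * y" "z' = c * z"
    using comp[of 1] comp[of 2] comp[of 3] unfolding cuv by (simp_all add: uv)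
  have e1: "a * X = - (\<alpha> * b * Y ^ s)" and e2: "b * X ^ s = - (\<beta> * a * Z)"
    and e3: "a * Y = - (\<gamma> * b * Z ^ s)"
    using comp[of 4] comp[of 5] comp[of 6] unfolding cuv
    by (simp_all add: uv c' J power_mult_distrib a_def b_def algebra_simps
        flip: X_def Y_def Z_def)
  have s: "s > 0"
    using q by (simp add: s_def)
  have XYZ: "\<not> (X = 0 \<and> Y = 0 \<and> Z = 0)"
  proof
    assume "X = 0 \<and> Y = 0 \<and> Z = 0"
    then have "x = 0" "y = 0" "z = 0"
      by (simp_all add: X_def Y_def Z_def)
    then have "u = 0"
      using q unfolding uv by (simp add: vec_eq_iff forall_6 zero_power)
    then show False using u(2) by simp
  qed
  have "a = 0 \<and> b = 0"
  proof (rule ccontr)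
    assume "\<not> (a = 0 \<and> b = 0)"
    \<comment> \<open>When exactly one of \<open>a\<close>, \<open>b\<close> is zero, the equations
      kill \<open>X\<close>, \<open>Y\<close> and \<open>Z\<close>; when neither is,
      \<open>X = 0\<close> or \<open>Z = 0\<close> makes the other two vanish as well.\<close>
    with e1 e2 e3 XYZ s assms(11-13) have ne: "a \<noteq> 0" "X \<noteq> 0" "Z \<noteq> 0"
      by (auto simp: zero_power)
    \<comment> \<open>Additivity applied to \<open>w + (- w) = 0\<close> covers odd and even
      characteristic at once.\<close>
    have "(- w) ^ s = - (w ^ s)" for w :: 'a
      using freshmans_dream_CARD[OF assms(1,4), of w "- w" K] s
      by (simp add: s_def zero_power eq_neg_iff_add_eq_0 add.commute)
    from cyclic_system_ratio_power[OF this ne e1 e2 e3]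
    have "(X / Z) ^ A = \<alpha> * \<gamma> ^ s * \<beta> ^ (s + 1)"
      by (simp only: assms(10) s_def power_mult mult.commute[of 2] power_even_eq)
    then show False
      using assms(15) by (auto simp: s_def)
  qed
  then have "c ^ (q ^ I) = c" "c ^ (q ^ J) = c"
    by (simp_all add: a_def b_def)
  moreover have "c ^ (q ^ n) = c"
    using power_card_eq_self[of c] assms(4) by simp
  \<comment> \<open>The gcd is 1, so \<open>c\<close> is fixed by the \<open>q\<close>-power map
    itself.\<close>
  ultimately have "c ^ (q ^ gcd I (gcd J n)) = c"
    by (intro power_gcd_fixed)
  then show "c \<in> range \<iota>"
    using assms(3,14) power_CARD_fixed_iff_range[OF assms(5), of c] by simp
qed

end
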